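(* Every sequent provable in $\mathsf{RTC}_{G}$ is provable in $\mathsf{NCRTC}^{\omega}_{G}$ (i.e. $\mathsf{NCRTC}^{\omega}_{G}\supseteq\mathsf{RTC}_{G}$).
   Context: Formulas of $\mathcal{L}_{\mathsf{RTC}}$: first-order formulas with equality extended by $(RTC_{x,y}\,\varphi)(s,t)$ for distinct variables $x,y$ bound in $\varphi$ and terms $s,t$. $\mathcal{LK}_=$: classical sequent calculus with axiom $\varphi\Rightarrow\varphi$, weakening, usual connective/quantifier rules (eigenvariable conditions), $(=L_1)$: from $\Gamma\Rightarrow\varphi[s/x],\Delta$ infer $\Gamma,s=t\Rightarrow\varphi[t/x],\Delta$, $(=L_2)$: from $\Gamma\Rightarrow\varphi[t/x],\Delta$ infer $\Gamma,s=t\Rightarrow\varphi[s/x],\Delta$, $(=R)$: $\Rightarrow t=t$, Cut, and (Subst): from $\Gamma\Rightarrow\Delta$ infer $\Gamma\theta\Rightarrow\Delta\theta$. Rules: (Refl) $\Gamma\Rightarrow\Delta,(RTC_{x,y}\varphi)(s,s)$; (Trans) from $\Gamma\Rightarrow\Delta,(RTC_{x,y}\varphi)(s,r)$ and $\Gamma\Rightarrow\Delta,\varphi[r/x,t/y]$ infer $\Gamma\Rightarrow\Delta,(RTC_{x,y}\varphi)(s,t)$; (Ind) from $\Gamma,\psi(x),\varphi(x,y)\Rightarrow\Delta,\psi[y/x]$ infer $\Gamma,\psi[s/x],(RTC_{x,y}\varphi)(s,t)\Rightarrow\Delta,\psi[t/x]$ with $x\notin fv(\Gamma,\Delta)$,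 $y\notin fv(\Gamma,\Delta,\psi)$; (Case) from $\Gamma,s=t\Rightarrow\Delta$ and $\Gamma,(RTC_{x,y}\varphi)(s,z),\varphi[z/x,t/y]\Rightarrow\Delta$ infer $\Gamma,(RTC_{x,y}\varphi)(s,t)\Rightarrow\Delta$, $z$ fresh, $(RTC_{x,y}\varphi)(s,z)$ being the immediate ancestor of the principal formula. $\mathsf{RTC}_G$ = $\mathcal{LK}_=$ + (Refl), (Trans), (Ind), with finite derivation trees as proofs. $\mathsf{RTC}^{\omega}_G$ = $\mathcal{LK}_=$ + (Refl), (Trans), (Case); a pre-proof is a possibly infinite derivation tree with no open leaves; a trace pair $(\tau,\tau')$ between $RTC$-formulas in the antecedents of a conclusion and a premise holds if the rule is (Subst) with $\tau=\tau'\theta$, or the rule is (Case) and $\tau$ is principal and $\tau'$ its immediate ancestor (progressing), or $\tau=\tau'$ otherwise; a trace follows a path if from some offset consecutive formulas are trace pairs along it; a proof is a pre-proof in which every infinite path is followed by a trace with infinitely many progressing pairs. A regular proof (finitely many distinct subtrees) is represented as a finite derivation tree some of whose leaves (buds) are each linked to an internal node (companion) labelled with the same sequent, giving a finite graph. A basic cycle in this graph is a path starting and ending at the same node with no other repeated nodes; two distinct basic cycles (not identical up to cyclic permutation) overlap if they share a node. $\mathsf{NCRTC}^{\omega}_G$ is the subsystem of $\mathsf{RTC}^{\omega}_G$ consisting of all and only the cyclic proofs that are non-overlapping, i.e. in which no two distinct basic cycles overlap. *)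

theory Defs
  imports Main "HOL-Library.FSet"
begin

section \<open>Terms and formulas\<close>

text \<open>
  Formulas are taken up to renaming of bound variables: binders are nameless (de Bruijn), whereas
  the free variables of a formula that is not below a binder are named by natural numbers. The
  named binders \<open>ALLV\<close>, \<open>EXV\<close> and \<open>RTCV\<close> below are the ones used in all inference rules.
\<close>

datatype 'f tm = Var nat | Fn 'f "'f tm list"

text \<open>
  \<open>All\<close> and \<open>Ex\<close> bind index 0; \<open>RTC \<phi> s t\<close> binds indices 0 and 1 in \<open>\<phi>\<close> and nothing in \<open>s\<close>, \<open>t\<close>.
\<close>

datatype ('f, 'p) fm =
    Eq "'f tm" "'f tm"
  | Pr 'p "'f tm list"
  | Neg "('f, 'p) fm"
  | Con "('f, 'p) fm" "('f, 'p) fm"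
  | Dis "('f, 'p) fm" "('f, 'p) fm"
  | Imp "('f, 'p) fm" "('f, 'p) fm"
  | All "('f, 'p) fm"
  | Ex "('f, 'p) fm"
  | RTC "('f, 'p) fm" "'f tm" "'f tm"

text \<open>A signature assigns an arity to each of its symbols; \<open>None\<close> means that it lacks the symbol.\<close>

record ('f, 'p) signature =
  fun_arity :: "'f \<rightharpoonup> nat"
  pred_arity :: "'p \<rightharpoonup> nat"

primrec wf_tm :: "('f, 'p) signature \<Rightarrow> 'f tm \<Rightarrow> bool" where
  "wf_tm \<Sigma> (Var n) \<longleftrightarrow> True"
| "wf_tm \<Sigma> (Fn f ts) \<longleftrightarrow> fun_arity \<Sigma> f = Some (length ts) \<and> list_all (wf_tm \<Sigma>) ts"

primrec wf_fm :: "('f, 'p) signature \<Rightarrow> ('f, 'p) fm \<Rightarrow> bool" where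
  "wf_fm \<Sigma> (Eq s t) \<longleftrightarrow> wf_tm \<Sigma> s \<and> wf_tm \<Sigma> t"
| "wf_fm \<Sigma> (Pr P ts) \<longleftrightarrow> pred_arity \<Sigma> P = Some (length ts) \<and> list_all (wf_tm \<Sigma>) ts"
| "wf_fm \<Sigma> (Neg \<phi>) \<longleftrightarrow> wf_fm \<Sigma> \<phi>"
| "wf_fm \<Sigma> (Con \<phi> \<psi>) \<longleftrightarrow> wf_fm \<Sigma> \<phi> \<and> wf_fm \<Sigma> \<psi>"
| "wf_fm \<Sigma> (Dis \<phi> \<psi>) \<longleftrightarrow> wf_fm \<Sigma> \<phi> \<and> wf_fm \<Sigma> \<psi>"
| "wf_fm \<Sigma> (Imp \<phi> \<psi>) \<longleftrightarrow> wf_fm \<Sigma> \<phi> \<and> wf_fm \<Sigma> \<psi>"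
| "wf_fm \<Sigma> (All \<phi>) \<longleftrightarrow> wf_fm \<Sigma> \<phi>"
| "wf_fm \<Sigma> (Ex \<phi>) \<longleftrightarrow> wf_fm \<Sigma> \<phi>"
| "wf_fm \<Sigma> (RTC \<phi> s t) \<longleftrightarrow> wf_fm \<Sigma> \<phi> \<and> wf_tm \<Sigma> s \<and> wf_tm \<Sigma> t"

primrec fv_tm :: "'f tm \<Rightarrow> nat set" where
  "fv_tm (Var n) = {n}"
| "fv_tm (Fn f ts) = \<Union> (set (map fv_tm ts))"

primrec fv :: "('f, 'p) fm \<Rightarrow> nat set" where
  "fv (Eq s t) = fv_tm s \<union> fv_tm t"
| "fv (Pr P ts) = \<Union> (set (map fv_tm ts))"
| "fv (Neg \<phi>) = fv \<phi>"
| "fv (Con \<phi> \<psi>) = fv \<phi> \<union> fv \<psi>"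
| "fv (Dis \<phi> \<psi>) = fv \<phi> \<union> fv \<psi>"
| "fv (Imp \<phi> \<psi>) = fv \<phi> \<union> fv \<psi>"
| "fv (All \<phi>) = {n. Suc n \<in> fv \<phi>}"
| "fv (Ex \<phi>) = {n. Suc n \<in> fv \<phi>}"
| "fv (RTC \<phi> s t) = {n. Suc (Suc n) \<in> fv \<phi>} \<union> fv_tm s \<union> fv_tm t"

definition fvs :: "('f, 'p) fm fset \<Rightarrow> nat set" where
  "fvs \<Gamma> = (\<Union>\<phi>\<in>fset \<Gamma>. fv \<phi>)"

type_synonym 'f substitution = "nat \<Rightarrow> 'f tm"

primrec subst_tm :: "'f substitution \<Rightarrow> 'f tm \<Rightarrow> 'f tm" where
  "subst_tm \<theta> (Var n) = \<theta> n"
| "subst_tm \<theta> (Fn f ts) = Fn f (map (subst_tm \<theta>) ts)"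

definition lift :: "'f substitution \<Rightarrow> 'f substitution" where
  "lift \<theta> = (\<lambda>n. case n of 0 \<Rightarrow> Var 0 | Suc m \<Rightarrow> subst_tm (\<lambda>k. Var (Suc k)) (\<theta> m))"

primrec subst :: "'f substitution \<Rightarrow> ('f, 'p) fm \<Rightarrow> ('f, 'p) fm" where
  "subst \<theta> (Eq s t) = Eq (subst_tm \<theta> s) (subst_tm \<theta> t)"
| "subst \<theta> (Pr P ts) = Pr P (map (subst_tm \<theta>) ts)"
| "subst \<theta> (Neg \<phi>) = Neg (subst \<theta> \<phi>)"
| "subst \<theta> (Con \<phi> \<psi>) = Con (subst \<theta> \<phi>) (subst \<theta> \<psi>)"
| "subst \<theta> (Dis \<phi> \<psi>) = Dis (subst \<theta> \<phi>) (subst \<theta> \<psi>)"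
| "subst \<theta> (Imp \<phi> \<psi>) = Imp (subst \<theta> \<phi>) (subst \<theta> \<psi>)"
| "subst \<theta> (All \<phi>) = All (subst (lift \<theta>) \<phi>)"
| "subst \<theta> (Ex \<phi>) = Ex (subst (lift \<theta>) \<phi>)"
| "subst \<theta> (RTC \<phi> s t) = RTC (subst (lift (lift \<theta>)) \<phi>) (subst_tm \<theta> s) (subst_tm \<theta> t)"

definition subst1 :: "('f, 'p) fm \<Rightarrow> 'f tm \<Rightarrow> nat \<Rightarrow> ('f, 'p) fm"  ("_\<langle>_'/_\<rangle>" [1000, 0, 0] 1000)
  where "\<phi>\<langle>s/x\<rangle> = subst (Var(x := s)) \<phi>"

definition subst2 :: "('f, 'p) fm \<Rightarrow> 'f tm \<Rightarrow> nat \<Rightarrow> 'f tm \<Rightarrow> nat \<Rightarrow> ('f, 'p) fm"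
    ("_\<langle>_'/_, _'/_\<rangle>" [1000, 0, 0, 0, 0] 1000)
  where "\<phi>\<langle>s/x, t/y\<rangle> = subst (Var(x := s, y := t)) \<phi>"

text \<open>Binding the named variables \<open>x\<close> and \<open>y\<close> of \<open>\<phi>\<close>: they become indices, all others are shifted.\<close>

definition ALLV :: "nat \<Rightarrow> ('f, 'p) fm \<Rightarrow> ('f, 'p) fm" where
  "ALLV x \<phi> = All (subst (\<lambda>n. if n = x then Var 0 else Var (Suc n)) \<phi>)"

definition EXV :: "nat \<Rightarrow> ('f, 'p) fm \<Rightarrow> ('f, 'p) fm" where
  "EXV x \<phi> = Ex (subst (\<lambda>n. if n = x then Var 0 else Var (Suc n)) \<phi>)"

definition RTCV :: "nat \<Rightarrow> nat \<Rightarrow> ('f, 'p) fm \<Rightarrow> 'f tm \<Rightarrow> 'f tm \<Rightarrow> ('f, 'p) fm" where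
  "RTCV x y \<phi> s t =
     RTC (subst (\<lambda>n. if n = x then Var 0 else if n = y then Var 1 else Var (Suc (Suc n))) \<phi>) s t"


section \<open>Sequents and inference rules\<close>

text \<open>Sequents consist of finite sets, so that exchange and contraction are implicit.\<close>

datatype ('f, 'p) sequent =
  Sequent (ante: "('f, 'p) fm fset") (succ: "('f, 'p) fm fset")  (infix "\<turnstile>" 50)

definition wf_sequent :: "('f, 'p) signature \<Rightarrow> ('f, 'p) sequent \<Rightarrow> bool" where
  "wf_sequent \<Sigma> S \<longleftrightarrow> (\<forall>\<phi>\<in>fset (ante S |\<union>| succ S). wf_fm \<Sigma> \<phi>)"

text \<open>
  Labels record the data of a rule instance on which traces depend: the substitution of (Subst),
  and the principal formula of (Case) together with its immediate ancestor.
\<close>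

datatype ('f, 'p) label =
    Other
  | Subst "'f substitution"
  | Case "('f, 'p) fm" "('f, 'p) fm"

text \<open>
  In \<open>lk_rule l ps S\<close> and the other rule relations, \<open>ps\<close> lists the premises and \<open>S\<close> is the
  conclusion.
\<close>

inductive lk_rule ::
  "('f, 'p) label \<Rightarrow> ('f, 'p) sequent list \<Rightarrow> ('f, 'p) sequent \<Rightarrow> bool" where
  Ax: "lk_rule Other [] ({|\<phi>|} \<turnstile> {|\<phi>|})"
| WL: "lk_rule Other [\<Gamma> \<turnstile> \<Delta>] (finsert \<phi> \<Gamma> \<turnstile> \<Delta>)"
| WR: "lk_rule Other [\<Gamma> \<turnstile> \<Delta>] (\<Gamma> \<turnstile> finsert \<phi> \<Delta>)"
| NegL: "lk_rule Other [\<Gamma> \<turnstile> finsert \<phi> \<Delta>] (finsert (Neg \<phi>) \<Gamma> \<turnstile> \<Delta>)"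
| NegR: "lk_rule Other [finsert \<phi> \<Gamma> \<turnstile> \<Delta>] (\<Gamma> \<turnstile> finsert (Neg \<phi>) \<Delta>)"
| ConL: "lk_rule Other [finsert \<phi> (finsert \<psi> \<Gamma>) \<turnstile> \<Delta>] (finsert (Con \<phi> \<psi>) \<Gamma> \<turnstile> \<Delta>)"
| ConR: "lk_rule Other [\<Gamma> \<turnstile> finsert \<phi> \<Delta>, \<Gamma> \<turnstile> finsert \<psi> \<Delta>] (\<Gamma> \<turnstile> finsert (Con \<phi> \<psi>) \<Delta>)"
| DisL: "lk_rule Other [finsert \<phi> \<Gamma> \<turnstile> \<Delta>, finsert \<psi> \<Gamma> \<turnstile> \<Delta>] (finsert (Dis \<phi> \<psi>) \<Gamma> \<turnstile> \<Delta>)"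
| DisR: "lk_rule Other [\<Gamma> \<turnstile> finsert \<phi> (finsert \<psi> \<Delta>)] (\<Gamma> \<turnstile> finsert (Dis \<phi> \<psi>) \<Delta>)"
| ImpL: "lk_rule Other [\<Gamma> \<turnstile> finsert \<phi> \<Delta>, finsert \<psi> \<Gamma> \<turnstile> \<Delta>] (finsert (Imp \<phi> \<psi>) \<Gamma> \<turnstile> \<Delta>)"
| ImpR: "lk_rule Other [finsert \<phi> \<Gamma> \<turnstile> finsert \<psi> \<Delta>] (\<Gamma> \<turnstile> finsert (Imp \<phi> \<psi>) \<Delta>)"
| AllL: "lk_rule Other [finsert (\<phi>\<langle>t/x\<rangle>) \<Gamma> \<turnstile> \<Delta>] (finsert (ALLV x \<phi>) \<Gamma> \<turnstile> \<Delta>)"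
| AllR: "x \<notin> fvs \<Gamma> \<union> fvs \<Delta> \<Longrightarrow>
    lk_rule Other [\<Gamma> \<turnstile> finsert \<phi> \<Delta>] (\<Gamma> \<turnstile> finsert (ALLV x \<phi>) \<Delta>)"
| ExL: "x \<notin> fvs \<Gamma> \<union> fvs \<Delta> \<Longrightarrow>
    lk_rule Other [finsert \<phi> \<Gamma> \<turnstile> \<Delta>] (finsert (EXV x \<phi>) \<Gamma> \<turnstile> \<Delta>)"
| ExR: "lk_rule Other [\<Gamma> \<turnstile> finsert (\<phi>\<langle>t/x\<rangle>) \<Delta>] (\<Gamma> \<turnstile> finsert (EXV x \<phi>) \<Delta>)"
| EqL1: "lk_rule Other [\<Gamma> \<turnstile> finsert (\<phi>\<langle>s/x\<rangle>) \<Delta>] (finsert (Eq s t) \<Gamma> \<turnstile> finsert (\<phi>\<langle>t/x\<rangle>) \<Delta>)"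
| EqL2: "lk_rule Other [\<Gamma> \<turnstile> finsert (\<phi>\<langle>t/x\<rangle>) \<Delta>] (finsert (Eq s t) \<Gamma> \<turnstile> finsert (\<phi>\<langle>s/x\<rangle>) \<Delta>)"
| EqR: "lk_rule Other [] ({||} \<turnstile> {|Eq t t|})"
| Cut: "lk_rule Other [\<Gamma> \<turnstile> finsert \<phi> \<Delta>, finsert \<phi> \<Gamma> \<turnstile> \<Delta>] (\<Gamma> \<turnstile> \<Delta>)"
| Subst: "lk_rule (Subst \<theta>) [\<Gamma> \<turnstile> \<Delta>] (subst \<theta> |`| \<Gamma> \<turnstile> subst \<theta> |`| \<Delta>)"

inductive intro_rule ::
  "('f, 'p) label \<Rightarrow> ('f, 'p) sequent list \<Rightarrow> ('f, 'p) sequent \<Rightarrow> bool" where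
  Refl: "x \<noteq> y \<Longrightarrow> intro_rule Other [] (\<Gamma> \<turnstile> finsert (RTCV x y \<phi> s s) \<Delta>)"
| Trans: "x \<noteq> y \<Longrightarrow>
    intro_rule Other
      [\<Gamma> \<turnstile> finsert (RTCV x y \<phi> s r) \<Delta>, \<Gamma> \<turnstile> finsert (\<phi>\<langle>r/x, t/y\<rangle>) \<Delta>]
      (\<Gamma> \<turnstile> finsert (RTCV x y \<phi> s t) \<Delta>)"

inductive ind_rule ::
  "('f, 'p) label \<Rightarrow> ('f, 'p) sequent list \<Rightarrow> ('f, 'p) sequent \<Rightarrow> bool" where
  Ind: "x \<noteq> y \<Longrightarrow> x \<notin> fvs \<Gamma> \<union> fvs \<Delta> \<Longrightarrow> y \<notin> fvs \<Gamma> \<union> fvs \<Delta> \<union> fv \<psi> \<Longrightarrow>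
    ind_rule Other
      [finsert \<psi> (finsert \<phi> \<Gamma>) \<turnstile> finsert (\<psi>\<langle>Var y/x\<rangle>) \<Delta>]
      (finsert (\<psi>\<langle>s/x\<rangle>) (finsert (RTCV x y \<phi> s t) \<Gamma>) \<turnstile> finsert (\<psi>\<langle>t/x\<rangle>) \<Delta>)"

inductive case_rule ::
  "('f, 'p) label \<Rightarrow> ('f, 'p) sequent list \<Rightarrow> ('f, 'p) sequent \<Rightarrow> bool" where
  Case: "x \<noteq> y \<Longrightarrow> z \<notin> fvs \<Gamma> \<union> fvs \<Delta> \<union> fv (RTCV x y \<phi> s t) \<Longrightarrow>
    case_rule (Case (RTCV x y \<phi> s t) (RTCV x y \<phi> s (Var z)))
      [finsert (Eq s t) \<Gamma> \<turnstile> \<Delta>,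
       finsert (RTCV x y \<phi> s (Var z)) (finsert (\<phi>\<langle>Var z/x, t/y\<rangle>) \<Gamma>) \<turnstile> \<Delta>]
      (finsert (RTCV x y \<phi> s t) \<Gamma> \<turnstile> \<Delta>)"

definition G_rule ::
  "('f, 'p) label \<Rightarrow> ('f, 'p) sequent list \<Rightarrow> ('f, 'p) sequent \<Rightarrow> bool" where
  "G_rule l ps S \<longleftrightarrow> lk_rule l ps S \<or> intro_rule l ps S \<or> ind_rule l ps S"

definition omega_rule ::
  "('f, 'p) label \<Rightarrow> ('f, 'p) sequent list \<Rightarrow> ('f, 'p) sequent \<Rightarrow> bool" where
  "omega_rule l ps S \<longleftrightarrow> lk_rule l ps S \<or> intro_rule l ps S \<or> case_rule l ps S"


section \<open>The finitary system with explicit induction\<close>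

inductive RTC_G_provable :: "('f, 'p) signature \<Rightarrow> ('f, 'p) sequent \<Rightarrow> bool" for \<Sigma> where
  "G_rule l ps S \<Longrightarrow> wf_sequent \<Sigma> S \<Longrightarrow> (\<forall>p\<in>set ps. RTC_G_provable \<Sigma> p) \<Longrightarrow>
    RTC_G_provable \<Sigma> S"


section \<open>The infinitary system\<close>

codatatype ('f, 'p) itree =
  INode (ilabel: "('f, 'p) label") (iconc: "('f, 'p) sequent") (iprems: "('f, 'p) itree list")

coinductive preproof :: "('f, 'p) signature \<Rightarrow> ('f, 'p) itree \<Rightarrow> bool" for \<Sigma> where
  "omega_rule l (map iconc Ts) S \<Longrightarrow> wf_sequent \<Sigma> S \<Longrightarrow> (\<forall>T\<in>set Ts. preproof \<Sigma> T) \<Longrightarrow>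
    preproof \<Sigma> (INode l S Ts)"

definition infinite_path :: "('f, 'p) itree \<Rightarrow> (nat \<Rightarrow> ('f, 'p) itree) \<Rightarrow> bool" where
  "infinite_path T P \<longleftrightarrow> P 0 = T \<and> (\<forall>i. P (Suc i) \<in> set (iprems (P i)))"

text \<open>
  The variable \<open>z\<close> of (Case) is fresh, so the immediate ancestor \<open>\<tau>'\<close> does not occur in the left
  premise; hence a progressing pair always belongs to the right premise.
\<close>

definition progressing :: "('f, 'p) label \<Rightarrow> ('f, 'p) fm \<Rightarrow> ('f, 'p) fm \<Rightarrow> bool" where
  "progressing l \<tau> \<tau>' \<longleftrightarrow> l = Case \<tau> \<tau>'"

definition trace_pair ::
  "('f, 'p) label \<Rightarrow> ('f, 'p) sequent \<Rightarrow> ('f, 'p) sequent \<Rightarrow> ('f, 'p) fm \<Rightarrow> ('f, 'p) fm \<Rightarrow> bool" where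
  "trace_pair l S S' \<tau> \<tau>' \<longleftrightarrow>
     \<tau> |\<in>| ante S \<and> (\<exists>\<phi> s t. \<tau> = RTC \<phi> s t) \<and>
     \<tau>' |\<in>| ante S' \<and> (\<exists>\<phi> s t. \<tau>' = RTC \<phi> s t) \<and>
     (case l of
        Subst \<theta> \<Rightarrow> \<tau> = subst \<theta> \<tau>'
      | Case _ _ \<Rightarrow> progressing l \<tau> \<tau>' \<or> \<tau> = \<tau>'
      | Other \<Rightarrow> \<tau> = \<tau>')"

definition follows :: "(nat \<Rightarrow> ('f, 'p) fm) \<Rightarrow> (nat \<Rightarrow> ('f, 'p) itree) \<Rightarrow> nat \<Rightarrow> bool" where
  "follows \<tau> P k \<longleftrightarrow>
     (\<forall>i\<ge>k. trace_pair (ilabel (P i)) (iconc (P i)) (iconc (P (Suc i))) (\<tau> i) (\<tau> (Suc i)))"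

definition RTC_omega_proof :: "('f, 'p) signature \<Rightarrow> ('f, 'p) itree \<Rightarrow> bool" where
  "RTC_omega_proof \<Sigma> T \<longleftrightarrow> preproof \<Sigma> T \<and>
     (\<forall>P. infinite_path T P \<longrightarrow>
        (\<exists>\<tau> k. follows \<tau> P k \<and>
           infinite {i. i \<ge> k \<and> progressing (ilabel (P i)) (\<tau> i) (\<tau> (Suc i))}))"


section \<open>Cyclic proofs\<close>

datatype ('f, 'p) ctree =
    Inf (clabel: "('f, 'p) label") (conc: "('f, 'p) sequent") (prems: "('f, 'p) ctree list")
  | Bud (conc: "('f, 'p) sequent")
where
  "prems (Bud S) = []"

text \<open>Nodes are addressed by their positions.\<close>

fun subtree :: "('f, 'p) ctree \<Rightarrow> nat list \<Rightarrow> ('f, 'p) ctree option" where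
  "subtree D [] = Some D"
| "subtree D (i # p) = (if i < length (prems D) then subtree (prems D ! i) p else None)"

text \<open>
  A cyclic pre-proof is a finite tree \<open>D\<close> together with a map \<open>R\<close> from the positions of the buds to
  those of their companions; the values of \<open>R\<close> at other positions are irrelevant.
\<close>

definition cyclic_preproof ::
  "('f, 'p) signature \<Rightarrow> ('f, 'p) ctree \<Rightarrow> (nat list \<Rightarrow> nat list) \<Rightarrow> bool" where
  "cyclic_preproof \<Sigma> D R \<longleftrightarrow>
     (\<forall>p l S Ds. subtree D p = Some (Inf l S Ds) \<longrightarrow>
        omega_rule l (map conc Ds) S \<and> wf_sequent \<Sigma> S) \<and>
     (\<forall>p S. subtree D p = Some (Bud S) \<longrightarrow>
        (\<exists>l Ds. subtree D (R p) = Some (Inf l S Ds) \<and> Ds \<noteq> []))"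

text \<open>The infinite tree represented by \<open>D\<close> and \<open>R\<close>, from position \<open>p\<close> on.\<close>

definition deref :: "('f, 'p) ctree \<Rightarrow> (nat list \<Rightarrow> nat list) \<Rightarrow> nat list \<Rightarrow> nat list" where
  "deref D R p = (if \<exists>S. subtree D p = Some (Bud S) then R p else p)"

primcorec unfolding_at ::
  "('f, 'p) ctree \<Rightarrow> (nat list \<Rightarrow> nat list) \<Rightarrow> nat list \<Rightarrow> ('f, 'p) itree" where
  "ilabel (unfolding_at D R p) = clabel (the (subtree D (deref D R p)))"
| "iconc (unfolding_at D R p) = conc (the (subtree D (deref D R p)))"
| "iprems (unfolding_at D R p) =
     map (\<lambda>i. unfolding_at D R (deref D R p @ [i]))
       [0..<length (prems (the (subtree D (deref D R p))))]"

definition cyclic_proof ::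
  "('f, 'p) signature \<Rightarrow> ('f, 'p) ctree \<Rightarrow> (nat list \<Rightarrow> nat list) \<Rightarrow> bool" where
  "cyclic_proof \<Sigma> D R \<longleftrightarrow> cyclic_preproof \<Sigma> D R \<and> RTC_omega_proof \<Sigma> (unfolding_at D R [])"

text \<open>In the graph of a cyclic pre-proof, a bud is a node whose only successor is its companion.\<close>

definition edge ::
  "('f, 'p) ctree \<Rightarrow> (nat list \<Rightarrow> nat list) \<Rightarrow> nat list \<Rightarrow> nat list \<Rightarrow> bool" where
  "edge D R p q \<longleftrightarrow>
     (\<exists>l S Ds i. subtree D p = Some (Inf l S Ds) \<and> i < length Ds \<and> q = p @ [i]) \<or>
     (\<exists>S. subtree D p = Some (Bud S) \<and> q = R p)"

text \<open>The list \<open>[n\<^sub>1, \<dots>, n\<^sub>k]\<close> stands for the cycle that visits \<open>n\<^sub>1, \<dots>, n\<^sub>k, n\<^sub>1\<close> in this order.\<close>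

definition basic_cycle :: "('n \<Rightarrow> 'n \<Rightarrow> bool) \<Rightarrow> 'n list \<Rightarrow> bool" where
  "basic_cycle E ns \<longleftrightarrow> ns \<noteq> [] \<and> distinct ns \<and> successively E (ns @ [hd ns])"

definition non_overlapping :: "('n \<Rightarrow> 'n \<Rightarrow> bool) \<Rightarrow> bool" where
  "non_overlapping E \<longleftrightarrow>
     (\<forall>ns ms. basic_cycle E ns \<and> basic_cycle E ms \<and> (\<nexists>k. ms = rotate k ns) \<longrightarrow>
        set ns \<inter> set ms = {})"

definition NCRTC_omega_provable :: "('f, 'p) signature \<Rightarrow> ('f, 'p) sequent \<Rightarrow> bool" where
  "NCRTC_omega_provable \<Sigma> S \<longleftrightarrow>
     (\<exists>D R. conc D = S \<and> cyclic_proof \<Sigma> D R \<and> non_overlapping (edge D R))"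

end

theory Submission
  imports Defs
begin

text \<open>
  An induction with conclusion \<open>\<Gamma>, \<psi>[s/x], (RTC \<phi>)(s,t) \<turnstile> \<Delta>, \<psi>[t/x]\<close> is an instance of the sequent \<open>N\<close>
  in which \<open>t\<close> is a fresh variable \<open>v\<close>. (Case) applied to \<open>N\<close> leaves \<open>s = v\<close>, which is easy, and a
  sequent with \<open>(RTC \<phi>)(s,z)\<close> and \<open>\<phi>[z/x,v/y]\<close> in the antecedent. A cut on \<open>\<psi>[z/x]\<close> splits the
  latter into a weakening of \<open>N[z/v]\<close>, closed by a bud with companion \<open>N\<close>, and a weakening of an
  instance of the premise of the induction. Every induction thus yields a single progressing
  loop, which is left only towards subproofs that never return to it, so the loops are disjoint.
\<close>

section \<open>Substitution\<close>

lemma finite_fv_tm: "finite (fv_tm t)"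
  by (induction t) auto

lemma finite_fv: "finite (fv \<phi>)"
proof (induction \<phi>)
  case (All \<phi>)
  then show ?case using finite_vimageI[of "fv \<phi>" Suc] by (simp add: vimage_def)
next
  case (Ex \<phi>)
  then show ?case using finite_vimageI[of "fv \<phi>" Suc] by (simp add: vimage_def)
next
  case (RTC \<phi> s t)
  then show ?case using finite_vimageI[of "fv \<phi>" "\<lambda>n. Suc (Suc n)"]
    by (simp add: vimage_def finite_fv_tm inj_def)
qed (auto simp: finite_fv_tm)

lemma finite_fvs: "finite (fvs \<Gamma>)"
  by (simp add: fvs_def finite_fv)

lemma fvs_finsert [simp]: "fvs (finsert \<phi> \<Gamma>) = fv \<phi> \<union> fvs \<Gamma>"
  by (auto simp: fvs_def)

section \<open>Locality and composition of substitution\<close>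

lemma subst_tm_cong: "(\<And>n. n \<in> fv_tm t \<Longrightarrow> \<theta> n = \<theta>' n) \<Longrightarrow> subst_tm \<theta> t = subst_tm \<theta>' t"
  by (induction t) auto

lemma subst_tm_Var: "subst_tm Var t = t"
  by (induction t) (auto simp: map_idI)

lemma subst_tm_comp: "subst_tm \<theta> (subst_tm \<sigma> t) = subst_tm (\<lambda>n. subst_tm \<theta> (\<sigma> n)) t"
  by (induction t) auto

lemma lift_Var: "lift Var = Var"
  by (auto simp: lift_def split: nat.splits)

text \<open>The pointwise form lets it rewrite under the abstraction that the binder cases of
  \<open>subst_comp\<close> produce.\<close>

lemma lift_comp: "subst_tm (lift \<theta>) (lift \<sigma> n) = lift (\<lambda>n. subst_tm \<theta> (\<sigma> n)) n"
  by (auto simp: lift_def subst_tm_comp split: nat.splits)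

lemma subst_cong: "(\<And>n. n \<in> fv \<phi> \<Longrightarrow> \<theta> n = \<theta>' n) \<Longrightarrow> subst \<theta> \<phi> = subst \<theta>' \<phi>"
proof (induction \<phi> arbitrary: \<theta> \<theta>')
  case (Eq s t)
  then show ?case using subst_tm_cong[of s \<theta> \<theta>'] subst_tm_cong[of t \<theta> \<theta>'] by simp
next
  case (Pr P ts)
  have "subst_tm \<theta> t = subst_tm \<theta>' t" if "t \<in> set ts" for t
    using Pr that by (intro subst_tm_cong) auto
  then show ?case by simp
next
  case (Neg \<phi>)
  show ?case using Neg.IH[of \<theta> \<theta>'] Neg.prems by simp
next
  case (Con \<phi> \<psi>)
  show ?case using Con.IH(1)[of \<theta> \<theta>'] Con.IH(2)[of \<theta> \<theta>'] Con.prems by simp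
next
  case (Dis \<phi> \<psi>)
  show ?case using Dis.IH(1)[of \<theta> \<theta>'] Dis.IH(2)[of \<theta> \<theta>'] Dis.prems by simp
next
  case (Imp \<phi> \<psi>)
  show ?case using Imp.IH(1)[of \<theta> \<theta>'] Imp.IH(2)[of \<theta> \<theta>'] Imp.prems by simp
next
  case (All \<phi>)
  have "lift \<theta> n = lift \<theta>' n" if "n \<in> fv \<phi>" for n
    using that All.prems by (auto simp: lift_def split: nat.splits)
  then show ?case using All.IH[of "lift \<theta>" "lift \<theta>'"] by simp
next
  case (Ex \<phi>)
  have "lift \<theta> n = lift \<theta>' n" if "n \<in> fv \<phi>" for n
    using that Ex.prems by (auto simp: lift_def split: nat.splits)
  then show ?case using Ex.IH[of "lift \<theta>" "lift \<theta>'"] by simp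
next
  case (RTC \<phi> s t)
  have "lift (lift \<theta>) n = lift (lift \<theta>') n" if "n \<in> fv \<phi>" for n
    using that RTC.prems by (auto simp: lift_def split: nat.splits)
  then show ?case
    using RTC.IH[of "lift (lift \<theta>)" "lift (lift \<theta>')"] RTC.prems
      subst_tm_cong[of s \<theta> \<theta>'] subst_tm_cong[of t \<theta> \<theta>'] by simp
qed

lemma subst_Var: "subst Var \<phi> = \<phi>"
  by (induction \<phi>) (auto simp: subst_tm_Var lift_Var map_idI)

lemma subst_comp: "subst \<theta> (subst \<sigma> \<phi>) = subst (\<lambda>n. subst_tm \<theta> (\<sigma> n)) \<phi>"
  by (induction \<phi> arbitrary: \<theta> \<sigma>) (auto simp: subst_tm_comp lift_comp)

lemma wf_subst_tm: "wf_tm \<Sigma> t \<Longrightarrow> (\<And>n. wf_tm \<Sigma> (\<theta> n)) \<Longrightarrow> wf_tm \<Sigma> (subst_tm \<theta> t)"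
  by (induction t) (auto simp: list_all_iff)

lemma wf_lift: "(\<And>n. wf_tm \<Sigma> (\<theta> n)) \<Longrightarrow> wf_tm \<Sigma> (lift \<theta> n)"
  by (auto simp: lift_def wf_subst_tm split: nat.splits)

lemma wf_subst: "wf_fm \<Sigma> \<phi> \<Longrightarrow> (\<And>n. wf_tm \<Sigma> (\<theta> n)) \<Longrightarrow> wf_fm \<Sigma> (subst \<theta> \<phi>)"
  by (induction \<phi> arbitrary: \<theta>) (auto simp: list_all_iff wf_subst_tm wf_lift)

lemma wf_subst1: "wf_fm \<Sigma> \<phi> \<Longrightarrow> wf_tm \<Sigma> t \<Longrightarrow> wf_fm \<Sigma> (\<phi>\<langle>t/x\<rangle>)"
  by (auto simp: subst1_def intro: wf_subst)

lemma wf_subst2: "wf_fm \<Sigma> \<phi> \<Longrightarrow> wf_tm \<Sigma> s \<Longrightarrow> wf_tm \<Sigma> t \<Longrightarrow> wf_fm \<Sigma> (\<phi>\<langle>s/x, t/y\<rangle>)"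
  by (auto simp: subst2_def intro: wf_subst)

lemma wf_RTCV:
  "wf_fm \<Sigma> \<phi> \<Longrightarrow> wf_tm \<Sigma> s \<Longrightarrow> wf_tm \<Sigma> t \<Longrightarrow> wf_fm \<Sigma> (RTCV x y \<phi> s t)"
  by (auto simp: RTCV_def intro: wf_subst)

lemma subst_id: "(\<And>n. n \<in> fv \<phi> \<Longrightarrow> \<theta> n = Var n) \<Longrightarrow> subst \<theta> \<phi> = \<phi>"
  using subst_cong[of \<phi> \<theta> Var] by (simp add: subst_Var)

lemma subst_tm_id: "(\<And>n. n \<in> fv_tm t \<Longrightarrow> \<theta> n = Var n) \<Longrightarrow> subst_tm \<theta> t = t"
  using subst_tm_cong[of t \<theta> Var] by (simp add: subst_tm_Var)

lemma subst_fset_id: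
  assumes "\<And>n. n \<in> fvs \<Gamma> \<Longrightarrow> \<theta> n = Var n"
  shows "subst \<theta> |`| \<Gamma> = \<Gamma>"
proof -
  have "subst \<theta> \<phi> = \<phi>" if "\<phi> |\<in>| \<Gamma>" for \<phi>
    using assms that by (intro subst_id) (auto simp: fvs_def)
  then show ?thesis by (auto simp: fimage_iff)
qed

text \<open>Freshness of \<open>v\<close>, read off an instance with some end point
  \<open>t\<close>, makes the substitution fix the bound body and \<open>s\<close>, so that only the
  end point moves. This is how the loop and the final conclusion are obtained from one generic
  sequent.\<close>

lemma subst_RTCV:
  assumes "v \<notin> fv (RTCV x y \<phi> s t)"
  shows "subst (Var(v := r)) (RTCV x y \<phi> s (Var v)) = RTCV x y \<phi> s r"
  using assms unfolding RTCV_def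
  by (auto intro!: subst_id subst_tm_id simp: lift_def split: nat.splits)

section \<open>Ranked cyclic pre-proofs\<close>

text \<open>
  Along an edge the rank never increases, and for at most one successor it is preserved. Thus a
  cycle is determined by any of its nodes, and an infinite path eventually has constant rank, from
  where on \<open>\<tau>\<close> yields a trace. It progresses infinitely often because \<open>m\<close> decreases otherwise.
\<close>

definition ranked ::
  "('f, 'p) ctree \<Rightarrow> (nat list \<Rightarrow> nat list) \<Rightarrow> (nat list \<Rightarrow> nat) \<Rightarrow> (nat list \<Rightarrow> ('f, 'p) fm) \<Rightarrow>
    (nat list \<Rightarrow> nat) \<Rightarrow> bool" where
  "ranked D R rk \<tau> m \<longleftrightarrow>
     (\<forall>p l S Ds i. subtree D p = Some (Inf l S Ds) \<and> i < length Ds \<longrightarrow>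
        rk (p @ [i]) < rk p \<or>
        rk (p @ [i]) = rk p \<and> (\<forall>j<length Ds. rk (p @ [j]) = rk p \<longrightarrow> j = i) \<and>
          trace_pair l S (conc (Ds ! i)) (\<tau> p) (\<tau> (p @ [i])) \<and>
          (progressing l (\<tau> p) (\<tau> (p @ [i])) \<or> m (p @ [i]) < m p)) \<and>
     (\<forall>p S. subtree D p = Some (Bud S) \<longrightarrow> rk (R p) = rk p \<and> \<tau> (R p) = \<tau> p \<and> m (R p) = m p)"

lemma ranked_step:
  assumes "ranked D R rk \<tau> m" "subtree D p = Some (Inf l S Ds)" "i < length Ds"
  shows "rk (p @ [i]) < rk p \<or>
    rk (p @ [i]) = rk p \<and> (\<forall>j<length Ds. rk (p @ [j]) = rk p \<longrightarrow> j = i) \<and>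
      trace_pair l S (conc (Ds ! i)) (\<tau> p) (\<tau> (p @ [i])) \<and>
      (progressing l (\<tau> p) (\<tau> (p @ [i])) \<or> m (p @ [i]) < m p)"
  using assms unfolding ranked_def by blast

section \<open>Positions, subtrees and dereferencing\<close>

lemma subtree_append:
  "subtree D (p @ q) = (case subtree D p of None \<Rightarrow> None | Some D' \<Rightarrow> subtree D' q)"
  by (induction D p rule: subtree.induct) auto

lemma subtree_Inf:
  "subtree (Inf l S Ds) p = Some D \<longleftrightarrow> p = [] \<and> D = Inf l S Ds \<or>
    (\<exists>i q. p = i # q \<and> i < length Ds \<and> subtree (Ds ! i) q = Some D)"
  by (cases p) auto

lemma subtree_Bud: "subtree (Bud S) p = Some D \<longleftrightarrow> p = [] \<and> D = Bud S"
  by (cases p) auto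

lemma subtree_snoc:
  "subtree D p = Some (Inf l S Ds) \<Longrightarrow> i < length Ds \<Longrightarrow> subtree D (p @ [i]) = Some (Ds ! i)"
  by (simp add: subtree_append)

text \<open>Companions are inference nodes, so one jump from a bud suffices, and it keeps the
  sequent.\<close>

lemma subtree_deref:
  assumes "cyclic_preproof \<Sigma> D R" and "subtree D p = Some D'"
  obtains l S Ds where "subtree D (deref D R p) = Some (Inf l S Ds)" "conc D' = S"
proof (cases D')
  case (Inf l S Ds)
  then show thesis using assms that by (auto simp: deref_def)
next
  case (Bud S)
  then have "deref D R p = R p" using assms by (auto simp: deref_def)
  then show thesis using assms that Bud unfolding cyclic_preproof_def by fastforce
qed

lemma ranked_deref:
  "ranked D R rk \<tau> m \<Longrightarrow>
    rk (deref D R p) = rk p \<and> \<tau> (deref D R p) = \<tau> p \<and> m (deref D R p) = m p"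
  by (auto simp: ranked_def deref_def)

lemma preproof_unfolding:
  assumes cp: "cyclic_preproof \<Sigma> D R"
  shows "subtree D p = Some D' \<Longrightarrow> preproof \<Sigma> (unfolding_at D R p)"
proof (coinduction arbitrary: p D' rule: preproof.coinduct)
  case preproof
  let ?q = "deref D R p"
  obtain l S Ds where q: "subtree D ?q = Some (Inf l S Ds)"
    using subtree_deref[OF cp preproof] .
  let ?Ts = "map (\<lambda>i. unfolding_at D R (?q @ [i])) [0..<length Ds]"
  have eq: "unfolding_at D R p = INode l S ?Ts"
    by (rule itree.expand) (simp add: q)
  \<comment> \<open>A premise may be a bud. Its unfolding then begins at the companion, which
    carries the same sequent, so the rule instance is preserved.\<close>
  have "conc (the (subtree D (deref D R (?q @ [i])))) = conc (Ds ! i)" if "i < length Ds" for i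
    using subtree_deref[OF cp subtree_snoc[OF q that]] by (metis ctree.sel(2) option.sel)
  then have "map iconc ?Ts = map conc Ds"
    by (auto intro!: nth_equalityI)
  moreover have "omega_rule l (map conc Ds) S" "wf_sequent \<Sigma> S"
    using cp q unfolding cyclic_preproof_def by blast+
  ultimately show ?case
    using eq subtree_snoc[OF q] by fastforce
qed

section \<open>The trace condition for ranked pre-proofs\<close>

lemma eventually_const_nat:
  fixes f :: "nat \<Rightarrow> nat"
  assumes "\<And>i. f (Suc i) \<le> f i"
  obtains k where "\<And>i. i \<ge> k \<Longrightarrow> f (Suc i) = f i"
proof -
  \<comment> \<open>An index at which the nonincreasing sequence attains its least value.\<close>
  obtain k where k: "\<And>j. f k \<le> f j"
    using ex_has_least_nat[of "\<lambda>_. True" 0 f] by auto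
  have "f i \<le> f k" if "i \<ge> k" for i
    using that by (induction i rule: dec_induct) (auto intro: order_trans[OF assms])
  then have "f (Suc i) = f i" if "i \<ge> k" for i
    using k that by (metis le_Suc_eq order_antisym)
  then show thesis using that by blast
qed

lemma ranked_omega_proof:
  assumes cp: "cyclic_preproof \<Sigma> D R" and rkd: "ranked D R rk \<tau> m"
  shows "RTC_omega_proof \<Sigma> (unfolding_at D R [])"
  unfolding RTC_omega_proof_def
proof (intro conjI allI impI)
  show "preproof \<Sigma> (unfolding_at D R [])"
    by (rule preproof_unfolding[OF cp]) simp
next
  fix P assume P: "infinite_path (unfolding_at D R []) P"
  \<comment> \<open>Different positions may have equal unfoldings, whereas the ranking lives on
    positions. The path of trees is therefore lifted to a sequence \<open>f\<close> of
    positions.\<close>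
  have "\<exists>f. \<forall>i. (P i = unfolding_at D R (f i) \<and> subtree D (f i) \<noteq> None) \<and>
    (\<exists>j < length (prems (the (subtree D (deref D R (f i))))). f (Suc i) = deref D R (f i) @ [j])"
  proof (rule dependent_nat_choice)
    show "\<exists>p. P 0 = unfolding_at D R p \<and> subtree D p \<noteq> None"
      using P by (intro exI[of _ "[]"]) (simp add: infinite_path_def)
  next
    fix p i assume p: "P i = unfolding_at D R p \<and> subtree D p \<noteq> None"
    then obtain D' where "subtree D p = Some D'" by auto
    from subtree_deref[OF cp this] obtain l S Ds
      where q: "subtree D (deref D R p) = Some (Inf l S Ds)" by blast
    have "P (Suc i) \<in> set (iprems (P i))" using P by (simp add: infinite_path_def)
    then obtain j where "j < length Ds" "P (Suc i) = unfolding_at D R (deref D R p @ [j])"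
      using p q by auto
    then show "\<exists>p'. (P (Suc i) = unfolding_at D R p' \<and> subtree D p' \<noteq> None) \<and>
      (\<exists>j < length (prems (the (subtree D (deref D R p)))). p' = deref D R p @ [j])"
      using q subtree_snoc[OF q] by auto
  qed
  then obtain f where f: "\<And>i. P i = unfolding_at D R (f i)" "\<And>i. subtree D (f i) \<noteq> None"
    and step: "\<And>i. \<exists>j < length (prems (the (subtree D (deref D R (f i))))).
      f (Suc i) = deref D R (f i) @ [j]"
    by blast
  \<comment> \<open>\<open>d i\<close> is the inference node met at step \<open>i\<close>, with the
    jump from a bud to its companion already made. Jumps leave \<open>rk\<close>, \<tau> and
    \<open>m\<close> unchanged.\<close>
  define d where "d i = deref D R (f i)" for i
  have main: "rk (d (Suc i)) < rk (d i) \<or> rk (d (Suc i)) = rk (d i) \<and>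
      trace_pair (ilabel (P i)) (iconc (P i)) (iconc (P (Suc i))) (\<tau> (d i)) (\<tau> (d (Suc i))) \<and>
      (progressing (ilabel (P i)) (\<tau> (d i)) (\<tau> (d (Suc i))) \<or> m (d (Suc i)) < m (d i))" for i
  proof -
    obtain D' where "subtree D (f i) = Some D'" using f(2) by blast
    from subtree_deref[OF cp this] obtain l S Ds
      where q: "subtree D (d i) = Some (Inf l S Ds)" unfolding d_def by blast
    obtain j where j: "j < length Ds" "f (Suc i) = d i @ [j]"
      using step[of i] q by (auto simp: d_def)
    obtain l' S' Ds' where "subtree D (d (Suc i)) = Some (Inf l' S' Ds')" "conc (Ds ! j) = S'"
      using subtree_deref[OF cp subtree_snoc[OF q j(1)]] j(2) unfolding d_def by metis
    then have "iconc (P (Suc i)) = conc (Ds ! j)"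
      using f(1) by (simp add: d_def)
    moreover have "ilabel (P i) = l" "iconc (P i) = S"
      using f(1) q by (simp_all add: d_def)
    moreover have "rk (d (Suc i)) = rk (d i @ [j]) \<and> \<tau> (d (Suc i)) = \<tau> (d i @ [j]) \<and>
        m (d (Suc i)) = m (d i @ [j])"
      using ranked_deref[OF rkd] j(2) by (metis d_def)
    ultimately show ?thesis
      using ranked_step[OF rkd q j(1)] by metis
  qed
  have "rk (d (Suc i)) \<le> rk (d i)" for i
    using main[of i] by auto
  from eventually_const_nat[of "\<lambda>i. rk (d i)", OF this]
  obtain k where k: "\<And>i. i \<ge> k \<Longrightarrow> rk (d (Suc i)) = rk (d i)" by blast
  let ?I = "{i. i \<ge> k \<and> progressing (ilabel (P i)) (\<tau> (d i)) (\<tau> (d (Suc i)))}"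
  have "infinite ?I"
  proof
    assume "finite ?I"
    then obtain n where n: "\<And>i. i \<in> ?I \<Longrightarrow> i < n"
      using finite_nat_set_iff_bounded by auto
    \<comment> \<open>Past \<open>k\<close> the rank is constant and past \<open>n\<close> no pair
      progresses, which leaves only the alternative that \<open>m\<close> drops.\<close>
    have desc: "m (d (Suc i)) < m (d i)" if "i \<ge> max k n" for i
      using main[of i] k[of i] n[of i] that by auto
    then have "(m (d (Suc (max k n + i))), m (d (max k n + i))) \<in> less_than" for i
      using desc[of "max k n + i"] by simp
    then have "\<forall>i. (m (d (max k n + Suc i)), m (d (max k n + i))) \<in> less_than"
      by simp
    then show False
      using wf_less_than[unfolded wf_iff_no_infinite_down_chain]
      by (elim notE) (rule exI[of _ "\<lambda>i. m (d (max k n + i))"])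
  qed
  moreover have "follows (\<lambda>i. \<tau> (d i)) P k"
    unfolding follows_def using main k by (metis nat_less_le)
  ultimately show "\<exists>\<tau> k. follows \<tau> P k \<and>
      infinite {i. i \<ge> k \<and> progressing (ilabel (P i)) (\<tau> i) (\<tau> (Suc i))}"
    by blast
qed

section \<open>Non-overlapping cycles\<close>

text \<open>Indices modulo the length turn the closing edge back to \<open>hd ns\<close> into an
  ordinary step.\<close>

lemma basic_cycle_edge:
  assumes "basic_cycle E ns" "i < length ns"
  shows "E (ns ! i) (ns ! (Suc i mod length ns))"
proof (cases "Suc i < length ns")
  case True
  then show ?thesis using assms successively_nth[of E "ns @ [hd ns]" i]
    by (simp add: basic_cycle_def nth_append)
next
  case False
  then have "Suc i = length ns" using assms by simp
  moreover have "ns \<noteq> []" using assms(2) by auto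
  moreover have "successively E (ns @ [hd ns])" using assms(1) by (simp add: basic_cycle_def)
  ultimately show ?thesis using assms(2) successively_nth[of E "ns @ [hd ns]" i]
    by (simp add: nth_append hd_conv_nth)
qed

lemma basic_cycle_rotate:
  assumes "basic_cycle E ns"
  shows "basic_cycle E (rotate k ns)"
proof -
  have "E (rotate k ns ! i) ((rotate k ns @ [hd (rotate k ns)]) ! Suc i)" if "i < length ns" for i
  proof -
    let ?n = "length ns"
    have "ns \<noteq> []" using that by auto
    then have "(rotate k ns @ [hd (rotate k ns)]) ! Suc i = rotate k ns ! (Suc i mod ?n)"
      using that by (cases "Suc i = ?n") (auto simp: nth_append hd_conv_nth)
    also have "\<dots> = ns ! (Suc ((k + i) mod ?n) mod ?n)"
      using that \<open>ns \<noteq> []\<close> by (simp add: nth_rotate mod_simps)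
    finally show ?thesis
      using basic_cycle_edge[OF assms, of "(k + i) mod ?n"] that \<open>ns \<noteq> []\<close>
      by (simp add: nth_rotate)
  qed
  then have "successively E (rotate k ns @ [hd (rotate k ns)])"
    by (auto simp: successively_conv_nth nth_append)
  then show ?thesis using assms by (simp add: basic_cycle_def)
qed

text \<open>Every rank on the cycle is at most that of the first node and at least that of the last.
  The closing edge bounds the former by the latter, so all are equal.\<close>

lemma basic_cycle_const:
  fixes rk :: "'n \<Rightarrow> nat"
  assumes "\<And>p q. E p q \<Longrightarrow> rk q \<le> rk p" and c: "basic_cycle E ns" and "i < length ns"
  shows "rk (ns ! i) = rk (ns ! 0)"
proof -
  have e: "rk (ns ! (Suc j mod length ns)) \<le> rk (ns ! j)" if "j < length ns" for j
    using assms(1) basic_cycle_edge[OF c that] .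
  have "i < length ns \<longrightarrow> rk (ns ! i) \<le> rk (ns ! 0)" for i
  proof (induction i)
    case (Suc i)
    then show ?case using e[of i] by fastforce
  qed simp
  moreover have "i < length ns \<longrightarrow> rk (ns ! (length ns - 1)) \<le> rk (ns ! (length ns - 1 - i))" for i
  proof (induction i)
    case (Suc i)
    have "Suc (length ns - 1 - Suc i) = length ns - 1 - i" if "Suc i < length ns" using that by simp
    then show ?case using e[of "length ns - 1 - Suc i"] Suc by fastforce
  qed simp
  from this[of "length ns - 1 - i"] have "rk (ns ! (length ns - 1)) \<le> rk (ns ! i)"
    using assms(3) by simp
  moreover have "rk (ns ! 0) \<le> rk (ns ! (length ns - 1))"
  proof -
    obtain n where "length ns = Suc n" using assms(3) by (cases "length ns") auto
    then show ?thesis using e[of n] by simp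
  qed
  ultimately show ?thesis
    using assms(3) by fastforce
qed

text \<open>Rank is constant on each cycle, so each step takes the unique rank-preserving successor.
  Two cycles through a common node therefore follow the same walk.\<close>

lemma non_overlapping_rank:
  fixes rk :: "'n \<Rightarrow> nat"
  assumes mono: "\<And>p q. E p q \<Longrightarrow> rk q \<le> rk p"
    and uniq: "\<And>p q q'. E p q \<Longrightarrow> E p q' \<Longrightarrow> rk q = rk p \<Longrightarrow> rk q' = rk p \<Longrightarrow> q = q'"
  shows "non_overlapping E"
  unfolding non_overlapping_def
proof (intro allI impI, rule ccontr)
  fix ns ms
  assume *: "basic_cycle E ns \<and> basic_cycle E ms \<and> (\<nexists>k. ms = rotate k ns)"
    and "set ns \<inter> set ms \<noteq> {}"
  then obtain a b where a: "a < length ns" and b: "b < length ms" and ab: "ns ! a = ms ! b"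
    by (auto simp: set_eq_iff in_set_conv_nth)
  \<comment> \<open>Both cycles are rotated to start at the shared node.\<close>
  define xs ys where "xs = rotate a ns" and "ys = rotate b ms"
  have c: "basic_cycle E xs" "basic_cycle E ys"
    using * by (simp_all add: xs_def ys_def basic_cycle_rotate)
  have ne: "xs \<noteq> []" "ys \<noteq> []" using c by (simp_all add: basic_cycle_def)
  have hd: "xs ! 0 = ys ! 0"
  proof -
    have "0 < length ns" "0 < length ms" using a b by auto
    then show ?thesis
      using a b ab nth_rotate[of 0 ns a] nth_rotate[of 0 ms b] by (simp add: xs_def ys_def)
  qed
  have walk: "xs ! (i mod length xs) = ys ! (i mod length ys)" for i
  proof (induction i)
    case (Suc i)
    have lt: "j mod length xs < length xs" "j mod length ys < length ys" for j using ne by simp_all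
    have "E (xs ! (i mod length xs)) (xs ! (Suc i mod length xs))"
      using basic_cycle_edge[OF c(1) lt(1)[of i]] by (simp add: mod_simps)
    moreover have "E (xs ! (i mod length xs)) (ys ! (Suc i mod length ys))"
      using basic_cycle_edge[OF c(2) lt(2)[of i]] Suc by (simp add: mod_simps)
    moreover have "rk (xs ! (j mod length xs)) = rk (xs ! 0)" for j
      by (rule basic_cycle_const[OF mono c(1) lt(1)])
    moreover have "rk (ys ! (j mod length ys)) = rk (xs ! 0)" for j
      unfolding hd by (rule basic_cycle_const[OF mono c(2) lt(2)])
    ultimately show ?case
      by (intro uniq[of "xs ! (i mod length xs)"]) simp_all
  qed (use hd in simp)
  \<comment> \<open>If \<open>vs\<close> were longer, then after \<open>length us\<close> steps the
    walk along \<open>us\<close> would be back at its start while \<open>vs\<close> has not closed,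
    so \<open>vs\<close> would repeat its first node.\<close>
  have le: "length vs \<le> length us"
    if w: "\<And>i. us ! (i mod length us) = vs ! (i mod length vs)" and "distinct vs" "us \<noteq> []" "vs \<noteq> []"
    for us vs :: "'n list"
  proof (rule ccontr)
    assume "\<not> length vs \<le> length us"
    then have lt: "length us < length vs" by simp
    have "vs ! length us = vs ! 0"
      using w[of "length us"] w[of 0] lt by simp
    then show False
      using \<open>distinct vs\<close> lt \<open>us \<noteq> []\<close> \<open>vs \<noteq> []\<close> by (simp add: nth_eq_iff_index_eq)
  qed
  have "length xs = length ys"
    using le[of xs ys, OF walk] le[of ys xs, OF walk[symmetric]] c by (simp add: basic_cycle_def)
  then have "xs = ys"
    using walk by (intro nth_equalityI) (metis mod_less)+
  \<comment> \<open>Rotating by \<open>length ms - b\<close> completes the rotation by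
    \<open>b\<close> to a full turn of \<open>ms\<close>, which exhibits \<open>ms\<close> as a
    rotation of \<open>ns\<close>.\<close>
  then have "rotate (length ms - b) (rotate a ns) = rotate (length ms - b) (rotate b ms)"
    by (simp add: xs_def ys_def)
  also have "\<dots> = ms"
    using b by (simp add: rotate_rotate)
  finally show False
    using * by (metis rotate_rotate)
qed

lemma ranked_non_overlapping:
  assumes "ranked D R rk \<tau> m"
  shows "non_overlapping (edge D R)"
proof (rule non_overlapping_rank[where rk = rk])
  show "rk q \<le> rk p" if "edge D R p q" for p q
    using that assms unfolding edge_def ranked_def by (metis eq_imp_le nat_less_le)
next
  fix p q q' assume e: "edge D R p q" "edge D R p q'" and r: "rk q = rk p" "rk q' = rk p"
  show "q = q'"
  proof (cases "\<exists>S. subtree D p = Some (Bud S)")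
    case True
    then show ?thesis using e by (auto simp: edge_def)
  next
    case False
    then obtain l S Ds i j where "subtree D p = Some (Inf l S Ds)" "i < length Ds" "j < length Ds"
      "q = p @ [i]" "q' = p @ [j]"
      using e unfolding edge_def by fastforce
    then show ?thesis using assms r unfolding ranked_def by (metis less_irrefl)
  qed
qed

section \<open>Simulation of induction\<close>

text \<open>The invariant of the induction over finite derivations: rankings of subproofs combine
  into one of the whole, and a ranking yields both the trace condition and the absence of
  overlaps.\<close>

definition ranked_provable :: "('f, 'p) signature \<Rightarrow> ('f, 'p) sequent \<Rightarrow> bool" where
  "ranked_provable \<Sigma> S \<longleftrightarrow>
     (\<exists>D R rk \<tau> m. conc D = S \<and> cyclic_preproof \<Sigma> D R \<and> ranked D R rk \<tau> m)"

lemma ranked_provable_NCRTC: "ranked_provable \<Sigma> S \<Longrightarrow> NCRTC_omega_provable \<Sigma> S"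
  unfolding ranked_provable_def NCRTC_omega_provable_def cyclic_proof_def
  using ranked_omega_proof ranked_non_overlapping by blast

section \<open>Closure under the rules of the infinitary system\<close>

lemma ranked_provable_rule:
  assumes rule: "omega_rule l Ss S" and wf: "wf_sequent \<Sigma> S"
    and prem: "\<And>S'. S' \<in> set Ss \<Longrightarrow> ranked_provable \<Sigma> S'"
  shows "ranked_provable \<Sigma> S"
proof -
  have "\<forall>i<length Ss. \<exists>D R rk \<tau> m. conc D = Ss ! i \<and> cyclic_preproof \<Sigma> D R \<and> ranked D R rk \<tau> m"
    using prem[OF nth_mem] unfolding ranked_provable_def by blast
  then obtain D R rk \<tau> m where
    D: "\<And>i. i < length Ss \<Longrightarrow> conc (D i) = Ss ! i"
      "\<And>i. i < length Ss \<Longrightarrow> cyclic_preproof \<Sigma> (D i) (R i)"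
      "\<And>i. i < length Ss \<Longrightarrow> ranked (D i) (R i) (rk i) (\<tau> i) (m i)"
    by metis
  define Ds where "Ds = map D [0..<length Ss]"
  have len: "length Ds = length Ss" and nth: "\<And>i. i < length Ss \<Longrightarrow> Ds ! i = D i"
    by (simp_all add: Ds_def)
  have concs: "map conc Ds = Ss"
    using D(1) by (auto simp: Ds_def intro: nth_equalityI)
  define D' where "D' = Inf l S Ds"
  define R' where "R' p = (case p of [] \<Rightarrow> [] | i # q \<Rightarrow> i # R i q)" for p
  \<comment> \<open>The sum bounds the rank of every subproof's root, so each edge out of the new
    root strictly lowers the rank. Hence the values of \<open>\<tau>'\<close> and \<open>m'\<close>
    at the root may be arbitrary.\<close>
  define rk' where "rk' p = (case p of [] \<Rightarrow> Suc (\<Sum>i<length Ss. rk i []) | i # q \<Rightarrow> rk i q)" for p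
  define \<tau>' where "\<tau>' p = (case p of [] \<Rightarrow> undefined | i # q \<Rightarrow> \<tau> i q)" for p
  define m' where "m' p = (case p of [] \<Rightarrow> 0 | i # q \<Rightarrow> m i q)" for p
  have sub: "subtree D' (i # q) = (if i < length Ss then subtree (D i) q else None)" for i q
    by (simp add: D'_def len nth)
  note subtree.simps(2) [simp del]
  have "cyclic_preproof \<Sigma> D' R'"
    unfolding cyclic_preproof_def
  proof (intro conjI allI impI)
    fix p l0 S0 Ds0 assume p: "subtree D' p = Some (Inf l0 S0 Ds0)"
    have "omega_rule l0 (map conc Ds0) S0 \<and> wf_sequent \<Sigma> S0"
    proof (cases p)
      case Nil
      then show ?thesis using p rule wf concs by (simp add: D'_def)
    next
      case (Cons i q)
      then show ?thesis
        using p sub D(2)[of i] unfolding cyclic_preproof_def by (metis option.distinct(1))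
    qed
    then show "omega_rule l0 (map conc Ds0) S0" "wf_sequent \<Sigma> S0" by auto
  next
    fix p S0 assume p: "subtree D' p = Some (Bud S0)"
    then obtain i q where "p = i # q"
      by (cases p) (auto simp: D'_def)
    then show "\<exists>l Ds. subtree D' (R' p) = Some (Inf l S0 Ds) \<and> Ds \<noteq> []"
      using p D(2)[of i] unfolding cyclic_preproof_def
      by (auto simp: sub R'_def split: if_splits)
  qed
  moreover have "ranked D' R' rk' \<tau>' m'"
  proof -
    have inner: "rk' (p @ [j]) < rk' p \<or>
        rk' (p @ [j]) = rk' p \<and> (\<forall>k<length Ds0. rk' (p @ [k]) = rk' p \<longrightarrow> k = j) \<and>
          trace_pair l0 S0 (conc (Ds0 ! j)) (\<tau>' p) (\<tau>' (p @ [j])) \<and>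
          (progressing l0 (\<tau>' p) (\<tau>' (p @ [j])) \<or> m' (p @ [j]) < m' p)"
      if 1: "subtree D' p = Some (Inf l0 S0 Ds0)" "j < length Ds0" for p l0 S0 Ds0 j
    proof (cases p)
      case Nil
      have "j < length Ss" using 1 len by (auto simp: Nil D'_def)
      then have "rk j [] \<le> (\<Sum>i<length Ss. rk i [])"
        by (intro member_le_sum) auto
      then show ?thesis by (simp add: Nil rk'_def)
    next
      case (Cons i q)
      then have i: "i < length Ss" "subtree (D i) q = Some (Inf l0 S0 Ds0)"
        using 1 by (auto simp: sub split: if_splits)
      show ?thesis
        using ranked_step[OF D(3)[OF i(1)] i(2)] 1
        by (simp add: Cons rk'_def \<tau>'_def m'_def)
    qed
    have bud: "rk' (R' p) = rk' p \<and> \<tau>' (R' p) = \<tau>' p \<and> m' (R' p) = m' p"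
      if p: "subtree D' p = Some (Bud S0)" for p S0
    proof -
      obtain i q where "p = i # q"
        using p by (cases p) (auto simp: D'_def)
      then show ?thesis
        using p D(3)[of i] unfolding ranked_def
        by (simp add: sub R'_def rk'_def \<tau>'_def m'_def split: if_splits)
    qed
    show ?thesis
      unfolding ranked_def using inner bud by blast
  qed
  moreover have "conc D' = S" by (simp add: D'_def)
  ultimately show ?thesis unfolding ranked_provable_def by blast
qed

text \<open>Builds the companion map, rank, trace formula and measure of the loop alike:
  \<open>g\<close> serves the nodes of the loop, \<open>a\<close> and \<open>c\<close> its two side
  subproofs.\<close>

definition graft ::
  "(nat list \<Rightarrow> 'x) \<Rightarrow> (nat list \<Rightarrow> 'x) \<Rightarrow> (nat list \<Rightarrow> 'x) \<Rightarrow> nat list \<Rightarrow> 'x" where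
  "graft a c g p = (case p of 0 # q \<Rightarrow> a q | Suc 0 # Suc 0 # q \<Rightarrow> c q | _ \<Rightarrow> g p)"

lemma graft_simps [simp]:
  "graft a c g (0 # q) = a q"
  "graft a c g (Suc 0 # Suc 0 # q) = c q"
  "graft a c g [] = g []"
  "graft a c g [Suc 0] = g [Suc 0]"
  "graft a c g (Suc 0 # 0 # q) = g (Suc 0 # 0 # q)"
  by (simp_all add: graft_def)

text \<open>
  The loop runs through a (Case), the left premise of a binary rule, two unary rules and a (Subst);
  the remaining premises \<open>A\<close> and \<open>C\<close> lie at positions \<open>[0]\<close> and \<open>[1, 1]\<close>.
\<close>

lemma ranked_provable_loop:
  assumes rules: "omega_rule (Case \<rho> \<rho>') [A, B1] N" "omega_rule Other [B2, C] B1"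
      "omega_rule Other [B3] B2" "omega_rule Other [B4] B3" "omega_rule (Subst \<theta>) [N] B4"
    and wf: "wf_sequent \<Sigma> N" "wf_sequent \<Sigma> B1" "wf_sequent \<Sigma> B2" "wf_sequent \<Sigma> B3" "wf_sequent \<Sigma> B4"
    and rtc: "\<exists>\<phi> s t. \<rho> = RTC \<phi> s t" "\<rho>' = subst \<theta> \<rho>"
    and mem: "\<rho> |\<in>| ante N" "\<rho>' |\<in>| ante B1" "\<rho>' |\<in>| ante B2" "\<rho>' |\<in>| ante B3" "\<rho>' |\<in>| ante B4"
    and sides: "ranked_provable \<Sigma> A" "ranked_provable \<Sigma> C"
  shows "ranked_provable \<Sigma> N"
proof -
  obtain DA RA rkA \<tau>A mA where
    A: "conc DA = A" "cyclic_preproof \<Sigma> DA RA" "ranked DA RA rkA \<tau>A mA"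
    using sides(1) unfolding ranked_provable_def by blast
  obtain DC RC rkC \<tau>C mC where
    C: "conc DC = C" "cyclic_preproof \<Sigma> DC RC" "ranked DC RC rkC \<tau>C mC"
    using sides(2) unfolding ranked_provable_def by blast
  define D4 where "D4 = Inf (Subst \<theta>) B4 [Bud N]"
  define D3 where "D3 = Inf Other B3 [D4]"
  define D2 where "D2 = Inf Other B2 [D3]"
  define D1 where "D1 = Inf Other B1 [D2, DC]"
  define D where "D = Inf (Case \<rho> \<rho>') N [DA, D1]"
  note D_defs = D4_def D3_def D2_def D1_def D_def
  \<comment> \<open>The only bud outside the side subproofs returns to the root.\<close>
  define R where "R = graft (\<lambda>q. 0 # RA q) (\<lambda>q. Suc 0 # Suc 0 # RC q) (\<lambda>_. [])"
  \<comment> \<open>Constant on the loop and above both side roots, so leaving the loop lowers the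
    rank.\<close>
  define rk where "rk = graft rkA rkC (\<lambda>_. Suc (rkA [] + rkC []))"
  \<comment> \<open>(Case) replaces \<rho> by \<open>\<rho>'\<close>, and (Subst) turns
    \<open>\<rho>'\<close> back into \<rho> at the bud, the loop position of length 5.\<close>
  define \<tau> where "\<tau> = graft \<tau>A \<tau>C (\<lambda>p. if p = [] \<or> length p = 5 then \<rho> else \<rho>')"
  \<comment> \<open>The measure may rise from 0 to 4 at the root because the (Case) edge progresses.
    It then falls by one per edge and is 0 again at the bud, in agreement with the
    companion.\<close>
  define m where "m = graft mA mC (\<lambda>p. if p = [] then 0 else 5 - length p)"
  have subtree_cases [consumes 1, case_names A C N B1 B2 B3 B4 Bud]: P
    if "subtree D p = Some T"
      "\<And>q. p = 0 # q \<Longrightarrow> subtree DA q = Some T \<Longrightarrow> P"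
      "\<And>q. p = Suc 0 # Suc 0 # q \<Longrightarrow> subtree DC q = Some T \<Longrightarrow> P"
      "p = [] \<Longrightarrow> T = D \<Longrightarrow> P"
      "p = [Suc 0] \<Longrightarrow> T = D1 \<Longrightarrow> P"
      "p = [Suc 0, 0] \<Longrightarrow> T = D2 \<Longrightarrow> P"
      "p = [Suc 0, 0, 0] \<Longrightarrow> T = D3 \<Longrightarrow> P"
      "p = [Suc 0, 0, 0, 0] \<Longrightarrow> T = D4 \<Longrightarrow> P"
      "p = [Suc 0, 0, 0, 0, 0] \<Longrightarrow> T = Bud N \<Longrightarrow> P"
    for p T P
    using that unfolding D_defs
    by (auto simp: subtree_Inf subtree_Bud less_Suc_eq simp del: subtree.simps)
  have sub: "subtree D (0 # q) = subtree DA q" "subtree D (Suc 0 # Suc 0 # q) = subtree DC q"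
    "subtree D [] = Some D" for q
    by (simp_all add: D_defs)
  note subtree.simps(2) [simp del]
  have "cyclic_preproof \<Sigma> D R"
    unfolding cyclic_preproof_def
  proof (intro conjI allI impI)
    fix p l S Ds assume "subtree D p = Some (Inf l S Ds)"
    then have "omega_rule l (map conc Ds) S \<and> wf_sequent \<Sigma> S"
    proof (cases rule: subtree_cases)
      case (A q)
      then show ?thesis using \<open>cyclic_preproof \<Sigma> DA RA\<close> unfolding cyclic_preproof_def by blast
    next
      case (C q)
      then show ?thesis using \<open>cyclic_preproof \<Sigma> DC RC\<close> unfolding cyclic_preproof_def by blast
    qed (use rules wf A(1) C(1) in \<open>simp_all add: D_defs\<close>)
    then show "omega_rule l (map conc Ds) S" "wf_sequent \<Sigma> S" by auto
  next
    fix p S assume "subtree D p = Some (Bud S)"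
    then show "\<exists>l Ds. subtree D (R p) = Some (Inf l S Ds) \<and> Ds \<noteq> []"
    proof (cases rule: subtree_cases)
      case (A q)
      then show ?thesis using \<open>cyclic_preproof \<Sigma> DA RA\<close> unfolding cyclic_preproof_def
        by (simp add: R_def sub)
    next
      case (C q)
      then show ?thesis using \<open>cyclic_preproof \<Sigma> DC RC\<close> unfolding cyclic_preproof_def
        by (simp add: R_def sub)
    next
      case Bud
      then show ?thesis by (simp add: R_def sub) (simp add: D_def)
    qed (simp_all add: D_defs)
  qed
  moreover have "ranked D R rk \<tau> m"
  proof -
    have inner: "rk (p @ [i]) < rk p \<or>
        rk (p @ [i]) = rk p \<and> (\<forall>j<length Ds. rk (p @ [j]) = rk p \<longrightarrow> j = i) \<and>
          trace_pair l S (conc (Ds ! i)) (\<tau> p) (\<tau> (p @ [i])) \<and>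
          (progressing l (\<tau> p) (\<tau> (p @ [i])) \<or> m (p @ [i]) < m p)"
      if "subtree D p = Some (Inf l S Ds)" "i < length Ds" for p l S Ds i
      using that(1)
    proof (cases rule: subtree_cases)
      case (A q)
      then show ?thesis using ranked_step[OF \<open>ranked DA RA rkA \<tau>A mA\<close> _ that(2)]
        by (simp add: rk_def \<tau>_def m_def)
    next
      case (C q)
      then show ?thesis using ranked_step[OF \<open>ranked DC RC rkC \<tau>C mC\<close> _ that(2)]
        by (simp add: rk_def \<tau>_def m_def)
    qed (use that(2) mem rtc in \<open>auto simp: D_defs less_Suc_eq rk_def \<tau>_def m_def trace_pair_def progressing_def\<close>)
    have bud: "rk (R p) = rk p \<and> \<tau> (R p) = \<tau> p \<and> m (R p) = m p" if "subtree D p = Some (Bud S)" for p S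
      using that
    proof (cases rule: subtree_cases)
      case (A q)
      then show ?thesis using \<open>ranked DA RA rkA \<tau>A mA\<close> unfolding ranked_def
        by (simp add: R_def rk_def \<tau>_def m_def)
    next
      case (C q)
      then show ?thesis using \<open>ranked DC RC rkC \<tau>C mC\<close> unfolding ranked_def
        by (simp add: R_def rk_def \<tau>_def m_def)
    qed (simp_all add: D_defs R_def rk_def \<tau>_def m_def)
    show ?thesis
      unfolding ranked_def using inner bud by blast
  qed
  moreover have "conc D = N" by (simp add: D_def)
  ultimately show ?thesis unfolding ranked_provable_def by blast
qed

section \<open>Weakening and the induction rule\<close>

lemma wf_sequent_simps [simp]:
  "wf_sequent \<Sigma> (finsert \<phi> \<Gamma> \<turnstile> \<Delta>) \<longleftrightarrow> wf_fm \<Sigma> \<phi> \<and> wf_sequent \<Sigma> (\<Gamma> \<turnstile> \<Delta>)"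
  "wf_sequent \<Sigma> (\<Gamma> \<turnstile> finsert \<phi> \<Delta>) \<longleftrightarrow> wf_fm \<Sigma> \<phi> \<and> wf_sequent \<Sigma> (\<Gamma> \<turnstile> \<Delta>)"
  by (auto simp: wf_sequent_def)

lemma ranked_provable_weaken:
  assumes "ranked_provable \<Sigma> (\<Gamma> \<turnstile> \<Delta>)" "wf_sequent \<Sigma> (\<Gamma>' |\<union>| \<Gamma> \<turnstile> \<Delta>' |\<union>| \<Delta>)"
  shows "ranked_provable \<Sigma> (\<Gamma>' |\<union>| \<Gamma> \<turnstile> \<Delta>' |\<union>| \<Delta>)"
  using assms(2)
proof (induction \<Gamma>')
  case empty
  then show ?case
  proof (induction \<Delta>')
    case empty
    then show ?case using assms(1) by simp
  next
    case (insert \<phi> \<Delta>')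
    have "omega_rule Other [\<Gamma> \<turnstile> \<Delta>' |\<union>| \<Delta>] (\<Gamma> \<turnstile> finsert \<phi> (\<Delta>' |\<union>| \<Delta>))"
      by (simp add: omega_rule_def WR)
    from ranked_provable_rule[OF this] show ?case
      using insert.IH insert.prems by simp
  qed
next
  case (insert \<phi> \<Gamma>')
  have "omega_rule Other [\<Gamma>' |\<union>| \<Gamma> \<turnstile> \<Delta>' |\<union>| \<Delta>]
      (finsert \<phi> (\<Gamma>' |\<union>| \<Gamma>) \<turnstile> \<Delta>' |\<union>| \<Delta>)"
    by (simp add: omega_rule_def WL)
  from ranked_provable_rule[OF this] show ?case
    using insert.IH insert.prems by simp
qed

lemma ranked_provable_Ind:
  fixes \<Gamma> \<Delta> :: "('f, 'p) fm fset" and \<phi> \<psi> :: "('f, 'p) fm"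
  assumes xy: "x \<noteq> y" "x \<notin> fvs \<Gamma> \<union> fvs \<Delta>" "y \<notin> fvs \<Gamma> \<union> fvs \<Delta> \<union> fv \<psi>"
    and prem: "ranked_provable \<Sigma> (finsert \<psi> (finsert \<phi> \<Gamma>) \<turnstile> finsert (\<psi>\<langle>Var y/x\<rangle>) \<Delta>)"
    and wfp: "wf_sequent \<Sigma> (finsert \<psi> (finsert \<phi> \<Gamma>) \<turnstile> finsert (\<psi>\<langle>Var y/x\<rangle>) \<Delta>)"
    and wfc: "wf_sequent \<Sigma>
      (finsert (\<psi>\<langle>s/x\<rangle>) (finsert (RTCV x y \<phi> s t) \<Gamma>) \<turnstile> finsert (\<psi>\<langle>t/x\<rangle>) \<Delta>)"
  shows "ranked_provable \<Sigma>
    (finsert (\<psi>\<langle>s/x\<rangle>) (finsert (RTCV x y \<phi> s t) \<Gamma>) \<turnstile> finsert (\<psi>\<langle>t/x\<rangle>) \<Delta>)"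
proof -
  \<comment> \<open>\<open>v\<close> must be fresh for everything that the substitutions for it are
    to leave alone: the contexts, \<open>\<psi>\<langle>s/x\<rangle>\<close>, \<open>s\<close> and
    the bound body of the RTC formula.\<close>
  define F where
    "F = fvs \<Gamma> \<union> fvs \<Delta> \<union> fv \<psi> \<union> fv (RTCV x y \<phi> s t) \<union> fv (\<psi>\<langle>s/x\<rangle>) \<union> {x, y}"
  have "finite F" by (simp add: F_def finite_fv finite_fvs)
  then obtain v where v: "v \<notin> F" using ex_new_if_finite infinite_UNIV_nat by blast
  \<comment> \<open>\<open>z\<close> is the eigenvariable of (Case) applied to \<open>N\<close>, so
    it must also avoid the formulas containing \<open>v\<close>.\<close>
  define F' where "F' = F \<union> {v} \<union> fv (\<psi>\<langle>Var v/x\<rangle>) \<union> fv (RTCV x y \<phi> s (Var v))"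
  have "finite F'" using \<open>finite F\<close> by (simp add: F'_def finite_fv)
  then obtain z where z: "z \<notin> F'" using ex_new_if_finite infinite_UNIV_nat by blast

  let ?\<psi>s = "\<psi>\<langle>s/x\<rangle>" and ?\<psi> = "\<lambda>u. \<psi>\<langle>u/x\<rangle>" and ?\<rho> = "\<lambda>u. RTCV x y \<phi> s u"
  let ?\<phi>zv = "\<phi>\<langle>Var z/x, Var v/y\<rangle>"
  define N where "N = (finsert (?\<rho> (Var v)) (finsert ?\<psi>s \<Gamma>) \<turnstile> finsert (?\<psi> (Var v)) \<Delta>)"

  have wf: "wf_fm \<Sigma> \<psi>" "wf_fm \<Sigma> \<phi>" "wf_fm \<Sigma> ?\<psi>s" "wf_tm \<Sigma> s" "wf_tm \<Sigma> t" "wf_sequent \<Sigma> (\<Gamma> \<turnstile> \<Delta>)"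
    using wfp wfc by (simp_all add: RTCV_def)
  have wfs: "wf_fm \<Sigma> (?\<rho> (Var u))" "wf_fm \<Sigma> (?\<psi> (Var u))" "wf_fm \<Sigma> ?\<phi>zv" for u
    using wf by (simp_all add: wf_RTCV wf_subst1 wf_subst2)

  have rename_\<psi>: "subst (Var(v := u)) (?\<psi> (Var v)) = ?\<psi> u" for u
    using v by (auto simp: subst1_def subst_comp F_def intro!: subst_cong)
  have rename_\<rho>: "subst (Var(v := u)) (?\<rho> (Var v)) = ?\<rho> u" for u
    using v by (intro subst_RTCV[of _ _ _ _ _ t]) (simp add: F_def)
  have rename: "subst (Var(v := u)) ?\<psi>s = ?\<psi>s"
      "subst (Var(v := u)) |`| \<Gamma> = \<Gamma>" "subst (Var(v := u)) |`| \<Delta> = \<Delta>" for u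
    using v by (auto simp: F_def intro!: subst_id subst_fset_id)
  \<comment> \<open>Used twice: with \<open>Var z\<close> to close the loop and with
    \<open>t\<close> to reach the conclusion.\<close>
  have subst_N: "omega_rule (Subst (Var(v := u))) [N]
      (finsert (?\<rho> u) (finsert ?\<psi>s \<Gamma>) \<turnstile> finsert (?\<psi> u) \<Delta>)" for u
    using Subst[of "Var(v := u)" "ante N" "succ N"]
    by (simp add: N_def omega_rule_def rename rename_\<psi> rename_\<rho>)

  \<comment> \<open>Turns the premise of the induction into the step from \<open>z\<close> to
    \<open>v\<close>. As \<open>y\<close> is not free in \<psi>, the hypothesis \<psi> becomes
    \<open>\<psi>\<langle>Var z/x\<rangle>\<close>, while
    \<open>\<psi>\<langle>Var y/x\<rangle>\<close> becomes
    \<open>\<psi>\<langle>Var v/x\<rangle>\<close>.\<close>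
  define \<sigma> where "\<sigma> = Var(x := Var z, y := Var v :: 'f tm)"
  have step_prem: "subst \<sigma> \<psi> = ?\<psi> (Var z)" "subst \<sigma> \<phi> = ?\<phi>zv"
      "subst \<sigma> (?\<psi> (Var y)) = ?\<psi> (Var v)" "subst \<sigma> |`| \<Gamma> = \<Gamma>" "subst \<sigma> |`| \<Delta> = \<Delta>"
    using xy by (auto simp: \<sigma>_def subst1_def subst2_def subst_comp intro!: subst_cong subst_fset_id)
  have step: "ranked_provable \<Sigma> (finsert (?\<psi> (Var z)) (finsert ?\<phi>zv \<Gamma>) \<turnstile> finsert (?\<psi> (Var v)) \<Delta>)"
  proof (rule ranked_provable_rule[where Ss = "[_]"])
    show "omega_rule (Subst \<sigma>) [finsert \<psi> (finsert \<phi> \<Gamma>) \<turnstile> finsert (\<psi>\<langle>Var y/x\<rangle>) \<Delta>]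
        (finsert (?\<psi> (Var z)) (finsert ?\<phi>zv \<Gamma>) \<turnstile> finsert (?\<psi> (Var v)) \<Delta>)"
      using Subst[of \<sigma> "finsert \<psi> (finsert \<phi> \<Gamma>)" "finsert (\<psi>\<langle>Var y/x\<rangle>) \<Delta>"]
      by (simp add: omega_rule_def step_prem)
  qed (use prem wf wfs in simp_all)

  have "ranked_provable \<Sigma> N"
  proof (rule ranked_provable_loop)
    show "omega_rule (Case (?\<rho> (Var v)) (?\<rho> (Var z)))
        [finsert (Eq s (Var v)) (finsert ?\<psi>s \<Gamma>) \<turnstile> finsert (?\<psi> (Var v)) \<Delta>,
         finsert (?\<rho> (Var z)) (finsert ?\<phi>zv (finsert ?\<psi>s \<Gamma>)) \<turnstile> finsert (?\<psi> (Var v)) \<Delta>] N"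
      unfolding N_def omega_rule_def using xy(1) z
      by (intro disjI2 case_rule.Case) (simp_all add: F'_def F_def)
    show "omega_rule Other
        [finsert (?\<rho> (Var z)) (finsert ?\<phi>zv (finsert ?\<psi>s \<Gamma>)) \<turnstile>
           finsert (?\<psi> (Var z)) (finsert (?\<psi> (Var v)) \<Delta>),
         finsert (?\<psi> (Var z)) (finsert (?\<rho> (Var z)) (finsert ?\<phi>zv (finsert ?\<psi>s \<Gamma>))) \<turnstile>
           finsert (?\<psi> (Var v)) \<Delta>]
        (finsert (?\<rho> (Var z)) (finsert ?\<phi>zv (finsert ?\<psi>s \<Gamma>)) \<turnstile> finsert (?\<psi> (Var v)) \<Delta>)"
      by (simp add: omega_rule_def Cut)
    show "omega_rule Other
        [finsert (?\<rho> (Var z)) (finsert ?\<phi>zv (finsert ?\<psi>s \<Gamma>)) \<turnstile> finsert (?\<psi> (Var z)) \<Delta>]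
        (finsert (?\<rho> (Var z)) (finsert ?\<phi>zv (finsert ?\<psi>s \<Gamma>)) \<turnstile>
           finsert (?\<psi> (Var z)) (finsert (?\<psi> (Var v)) \<Delta>))"
      unfolding omega_rule_def finsert_commute[of "?\<psi> (Var z)"] by (simp add: WR)
    show "omega_rule Other
        [finsert (?\<rho> (Var z)) (finsert ?\<psi>s \<Gamma>) \<turnstile> finsert (?\<psi> (Var z)) \<Delta>]
        (finsert (?\<rho> (Var z)) (finsert ?\<phi>zv (finsert ?\<psi>s \<Gamma>)) \<turnstile> finsert (?\<psi> (Var z)) \<Delta>)"
      unfolding omega_rule_def finsert_commute[of _ ?\<phi>zv] by (simp add: WL)
    show "omega_rule (Subst (Var(v := Var z))) [N]
        (finsert (?\<rho> (Var z)) (finsert ?\<psi>s \<Gamma>) \<turnstile> finsert (?\<psi> (Var z)) \<Delta>)"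
      by (rule subst_N)
    show "\<exists>\<chi> a b. ?\<rho> (Var v) = RTC \<chi> a b" by (simp add: RTCV_def)
    show "?\<rho> (Var z) = subst (Var(v := Var z)) (?\<rho> (Var v))" by (simp add: rename_\<rho>)
    \<comment> \<open>Base case of the induction: \<open>s = v\<close> rewrites a weakened axiom on
      \<open>\<psi>\<langle>s/x\<rangle>\<close>.\<close>
    show "ranked_provable \<Sigma> (finsert (Eq s (Var v)) (finsert ?\<psi>s \<Gamma>) \<turnstile> finsert (?\<psi> (Var v)) \<Delta>)"
    proof (rule ranked_provable_rule[where Ss = "[_]"])
      show "omega_rule Other [finsert ?\<psi>s \<Gamma> \<turnstile> finsert ?\<psi>s \<Delta>]
          (finsert (Eq s (Var v)) (finsert ?\<psi>s \<Gamma>) \<turnstile> finsert (?\<psi> (Var v)) \<Delta>)"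
        by (simp add: omega_rule_def EqL1)
      have "ranked_provable \<Sigma> ({|?\<psi>s|} \<turnstile> {|?\<psi>s|})"
        by (rule ranked_provable_rule[of Other "[]"])
          (use wf in \<open>simp_all add: omega_rule_def Ax wf_sequent_def\<close>)
      from ranked_provable_weaken[OF this, of \<Gamma> \<Delta>]
      show "ranked_provable \<Sigma> S" if "S \<in> set [finsert ?\<psi>s \<Gamma> \<turnstile> finsert ?\<psi>s \<Delta>]" for S
        using that wf by simp
    qed (use wf wfs in simp_all)
    \<comment> \<open>Right premise of the cut: the instantiated induction step, weakened.\<close>
    show "ranked_provable \<Sigma>
        (finsert (?\<psi> (Var z)) (finsert (?\<rho> (Var z)) (finsert ?\<phi>zv (finsert ?\<psi>s \<Gamma>))) \<turnstile>
           finsert (?\<psi> (Var v)) \<Delta>)"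
      using ranked_provable_weaken[OF step, of "{|?\<rho> (Var z), ?\<psi>s|}" "{||}"] wf wfs
      by (simp add: finsert_commute)
  qed (use wf wfs in \<open>simp_all add: N_def\<close>)
  \<comment> \<open>One (Subst) below the loop replaces \<open>v\<close> by the actual end
    point.\<close>
  then have "ranked_provable \<Sigma> (finsert (?\<rho> t) (finsert ?\<psi>s \<Gamma>) \<turnstile> finsert (?\<psi> t) \<Delta>)"
    by (intro ranked_provable_rule[OF subst_N[of t]]) (use wfc in simp_all)
  then show ?thesis by (simp add: finsert_commute)
qed

lemma RTC_G_provable_wf: "RTC_G_provable \<Sigma> S \<Longrightarrow> wf_sequent \<Sigma> S"
  by (erule RTC_G_provable.cases) simp

text \<open>The two systems share all rules except (Ind) and (Case), so only (Ind) has to be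
  simulated.\<close>

lemma RTC_G_ranked_provable: "RTC_G_provable \<Sigma> S \<Longrightarrow> ranked_provable \<Sigma> S"
proof (induction rule: RTC_G_provable.induct)
  case (1 l ps S)
  show ?case
  proof (cases "omega_rule l ps S")
    case True
    then show ?thesis by (rule ranked_provable_rule[OF _ 1(2)]) (use 1(3) in blast)
  next
    case False
    then have "ind_rule l ps S" using 1(1) unfolding G_rule_def omega_rule_def by blast
    then show ?thesis
    proof cases
      case (Ind x y \<Gamma> \<Delta> \<psi> \<phi> s t)
      have prem: "wf_sequent \<Sigma> p" "ranked_provable \<Sigma> p" if "p \<in> set ps" for p
        using bspec[OF 1(3) that] RTC_G_provable_wf by blast+
      show ?thesis
        unfolding Ind(3)
        by (rule ranked_provable_Ind[OF Ind(4-6)])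
          (use prem 1(2) Ind(2,3) in \<open>simp_all del: wf_sequent_simps\<close>)
    qed
  qed
qed

theorem theorem6:
  fixes \<Sigma> :: "('f, 'p) signature" and S :: "('f, 'p) sequent"
  assumes "RTC_G_provable \<Sigma> S"
  shows "NCRTC_omega_provable \<Sigma> S"
  using assms by (intro ranked_provable_NCRTC RTC_G_ranked_provable)

end
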